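(* Let $D$ be an oriented graph on $n$ vertices. If $d^-(v)+\omega^+(v)\geq n/2$ for every vertex $v\in V(D)$, then either $D$ contains a directed triangle, or $n$ is even and $D$ is an orientation of the complete bipartite graph $K_{n/2,n/2}$.
   Context: All graphs are simple and finite. An orientation of an undirected simple graph is a digraph obtained from it by replacing each edge with exactly one of the two possible arcs with the same ends; such a digraph is called an oriented graph. For a vertex $v$ of $D$, $d^-(v)$ is the in-degree of $v$, $N^+(v)$ is the set of out-neighbors of $v$, $D[N^+(v)]$ is the subdigraph of $D$ induced by $N^+(v)$, and the out-component number $\omega^+(v)$ is the number of components of $D[N^+(v)]$, where components are the connected components of the underlying undirected graph (so $\omega^+(v)=0$ if $N^+(v)=\emptyset$). A directed triangle is a directed cycle of length 3. *)

theory Defs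
  imports Complex_Main "Graph_Theory.Graph_Theory"
begin

text \<open>Following \<^theory>\<open>Graph_Theory.Digraph\<close>, a finite simple undirected graph is a
  symmetric digraph (locale \<^const>\<open>graph\<close>): the edge \<open>uv\<close> is the pair of arcs \<open>(u,v)\<close>, \<open>(v,u)\<close>.\<close>

definition orientation_of :: "('a,'b) pre_digraph \<Rightarrow> ('a,'c) pre_digraph \<Rightarrow> bool" where
  "orientation_of D G \<longleftrightarrow> digraph D \<and> graph G \<and> verts D = verts G \<and> arcs_ends D \<subseteq> arcs_ends G
    \<and> (\<forall>u v. u \<rightarrow>\<^bsub>G\<^esub> v \<longrightarrow> (u \<rightarrow>\<^bsub>D\<^esub> v) \<noteq> (v \<rightarrow>\<^bsub>D\<^esub> u))"

text \<open>Arcs of a simple graph are determined by their ends, so it is no restriction that the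
  existentially quantified simple graph has pairs of vertices as its arcs.\<close>

definition oriented_graph :: "('a,'b) pre_digraph \<Rightarrow> bool" where
  "oriented_graph D \<longleftrightarrow> (\<exists>G :: 'a pair_pre_digraph. orientation_of D (with_proj G))"

definition out_neighbors :: "('a,'b) pre_digraph \<Rightarrow> 'a \<Rightarrow> 'a set" where
  "out_neighbors D v = {w. v \<rightarrow>\<^bsub>D\<^esub> w}"

text \<open>\<^const>\<open>connected\<close> refers to the underlying undirected graph and is false for the graph
  without vertices.\<close>

definition components :: "('a,'b) pre_digraph \<Rightarrow> ('a,'b) pre_digraph set" where
  "components H = {C. pre_digraph.max_subgraph H connected C}"

definition out_component_number :: "('a,'b) pre_digraph \<Rightarrow> 'a \<Rightarrow> nat" where
  "out_component_number D v = card (components (D \<restriction> out_neighbors D v))"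

definition has_directed_triangle :: "('a,'b) pre_digraph \<Rightarrow> bool" where
  "has_directed_triangle D \<longleftrightarrow> (\<exists>p. pre_digraph.cycle D p \<and> length p = 3)"

end

theory Submission
  imports Defs
begin

text \<open>Write \<open>c(v) = d\<^sup>-(v) + \<omega>\<^sup>+(v)\<close>, so \<open>c(v) \<le> d(v)\<close>. It suffices to exclude transitive triangles:
  in a triangle-free graph with all degrees at least \<open>n/2\<close>, the neighbourhoods of the ends of an edge
  partition the vertices, which gives \<open>K\<^bsub>n/2,n/2\<^esub>\<close>. This is done by induction on \<open>n\<close>.

  If every arc \<open>uv\<close> has a common out-neighbour of its ends, then the components of all
  out-neighbourhoods have at least 4 vertices. Take \<open>v\<close> of maximum out-degree and, by induction,
  \<open>w \<in> N\<^sup>-(v)\<close> with \<open>c(w)\<close> at most half the order in \<open>D[N\<^sup>-(v)]\<close>; since \<open>N\<^sup>-(v) \<union> N\<^sup>-(w)\<close> and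
  \<open>N\<^sup>+(v)\<close> are disjoint, counting gives \<open>5 d\<^sup>+(v) < 2n\<close>, whereas averaging gives \<open>5 d\<^sup>+(v) \<ge> 2n\<close>.

  Otherwise choose an arc \<open>uv\<close> without common out-neighbour, preferably with \<open>v\<close> isolated in
  \<open>D[N\<^sup>+(u)]\<close>. Deleting \<open>u\<close> and \<open>v\<close> decreases every \<open>c(x)\<close> by at most 1, so by induction the rest is
  triangle-free and \<open>c(x)\<close> decreases by exactly 1. This excludes triangles through \<open>u\<close> or \<open>v\<close> if
  \<open>v\<close> is isolated, and is contradictory if no arc has that property.\<close>

section \<open>Neighbourhoods and components relative to a vertex set\<close>

locale triangle_avoiding =
  fixes E :: "'a \<Rightarrow> 'a \<Rightarrow> bool"
  assumes asym: "E x y \<Longrightarrow> \<not> E y x"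
    and no_cycle3: "E x y \<Longrightarrow> E y z \<Longrightarrow> \<not> E z x"
begin

definition adj :: "'a \<Rightarrow> 'a \<Rightarrow> bool" where
  "adj x y \<longleftrightarrow> E x y \<or> E y x"

text \<open>Neighbourhoods take a vertex set as argument because the induction deletes vertices
  while \<open>E\<close> stays fixed.\<close>

definition inn :: "'a set \<Rightarrow> 'a \<Rightarrow> 'a set" where
  "inn V x = {y \<in> V. E y x}"

definition out :: "'a set \<Rightarrow> 'a \<Rightarrow> 'a set" where
  "out V x = {y \<in> V. E x y}"

definition nbs :: "'a set \<Rightarrow> 'a \<Rightarrow> 'a set" where
  "nbs V x = {y \<in> V. adj x y}"

definition comp_of :: "'a set \<Rightarrow> 'a \<Rightarrow> 'a set" where
  "comp_of N x = {(a, b). a \<in> N \<and> b \<in> N \<and> adj a b}\<^sup>* `` {x}"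

definition ncomp :: "'a set \<Rightarrow> nat" where
  "ncomp N = card (comp_of N ` N)"

definition cdeg :: "'a set \<Rightarrow> 'a \<Rightarrow> nat" where
  "cdeg V x = card (inn V x) + ncomp (out V x)"

lemma irrefl: "\<not> E x x"
  using asym by blast

lemma adj_sym: "adj x y \<Longrightarrow> adj y x"
  by (auto simp: adj_def)

lemma adj_irrefl: "\<not> adj x x"
  by (simp add: adj_def irrefl)

lemma finite_inn [simp]: "finite V \<Longrightarrow> finite (inn V x)"
  and finite_out [simp]: "finite V \<Longrightarrow> finite (out V x)"
  and finite_nbs [simp]: "finite V \<Longrightarrow> finite (nbs V x)"
  by (auto simp: inn_def out_def nbs_def)

lemma card_nbs:
  assumes "finite V"
  shows "card (nbs V x) = card (inn V x) + card (out V x)"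
proof -
  have "nbs V x = inn V x \<union> out V x" "inn V x \<inter> out V x = {}"
    using asym by (auto simp: nbs_def inn_def out_def adj_def)
  then show ?thesis using assms by (simp add: card_Un_disjoint)
qed

lemma comp_of_refl: "x \<in> comp_of N x"
  by (simp add: comp_of_def)

lemma comp_of_eq:
  assumes "x \<in> N" "y \<in> N" "adj x y"
  shows "comp_of N x = comp_of N y"
proof -
  let ?R = "{(a, b). a \<in> N \<and> b \<in> N \<and> adj a b}"
  have "(x, y) \<in> ?R" "(y, x) \<in> ?R" using assms adj_sym by auto
  then show ?thesis unfolding comp_of_def
    by (auto intro: converse_rtrancl_into_rtrancl)
qed

text \<open>A map that agrees on the ends of every arc is constant on each component. Later
  \<open>f\<close> is the component map of a larger vertex set, or sends a vertex to its
  reachability class.\<close>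

lemma ncomp_ge:
  assumes "finite N" and f: "\<And>x y. x \<in> N \<Longrightarrow> y \<in> N \<Longrightarrow> E x y \<Longrightarrow> f x = f y"
  shows "card (f ` N) \<le> ncomp N"
proof -
  have const: "f y = f x" if "y \<in> comp_of N x" for x y
  proof -
    have "(x, y) \<in> {(a, b). a \<in> N \<and> b \<in> N \<and> adj a b}\<^sup>*" using that by (simp add: comp_of_def)
    then show ?thesis
    proof (induction rule: rtrancl_induct)
      case (step y z)
      then show ?case using f[of y z] f[of z y] by (auto simp: adj_def)
    qed simp
  qed
  \<comment> \<open>Each value of \<open>f\<close> is recovered from a component through an
    arbitrary representative of it.\<close>
  have "f ` N \<subseteq> (\<lambda>C. f (SOME z. z \<in> C)) ` comp_of N ` N"
  proof
    fix a assume "a \<in> f ` N"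
    then obtain x where x: "x \<in> N" "a = f x" by auto
    have "(SOME z. z \<in> comp_of N x) \<in> comp_of N x"
      using comp_of_refl someI by metis
    then have "f (SOME z. z \<in> comp_of N x) = a" using const x by simp
    then show "a \<in> (\<lambda>C. f (SOME z. z \<in> C)) ` comp_of N ` N" using x by force
  qed
  then have "card (f ` N) \<le> card ((\<lambda>C. f (SOME z. z \<in> C)) ` comp_of N ` N)"
    using assms(1) by (intro card_mono) auto
  also have "\<dots> \<le> ncomp N"
    unfolding ncomp_def using assms(1) by (intro card_image_le) auto
  finally show ?thesis .
qed

lemma ncomp_le_card: "finite N \<Longrightarrow> ncomp N \<le> card N"
  unfolding ncomp_def by (rule card_image_le)

lemma ncomp_less_card:
  assumes "finite N" "x \<in> N" "y \<in> N" "adj x y"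
  shows "ncomp N < card N"
proof -
  have "\<not> inj_on (comp_of N) N"
    using assms comp_of_eq adj_irrefl by (metis inj_onD)
  then show ?thesis
    using assms(1) ncomp_le_card eq_card_imp_inj_on unfolding ncomp_def
    by (metis card_image_le le_neq_implies_less)
qed

lemma cdeg_le: "finite V \<Longrightarrow> cdeg V x \<le> card (nbs V x)"
  using ncomp_le_card[of "out V x"] by (simp add: cdeg_def card_nbs)

text \<open>Two adjacent out-neighbours share a component. Hence a vertex whose \<open>cdeg\<close>
  equals its degree has an independent out-neighbourhood.\<close>

lemma cdeg_less:
  assumes "finite V" "y \<in> out V x" "z \<in> out V x" "adj y z"
  shows "cdeg V x < card (nbs V x)"
  using ncomp_less_card[of "out V x" y z] assms by (simp add: cdeg_def card_nbs)

text \<open>A component in which every vertex has an out-neighbour carries a directed walk \<open>a b c d\<close>,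
  whose vertices are distinct because there are no directed cycles of length at most 3.\<close>

lemma four_ncomp_le:
  assumes fin: "finite N" and succ: "\<And>a. a \<in> N \<Longrightarrow> \<exists>b \<in> N. E a b"
  shows "4 * ncomp N \<le> card N"
proof -
  have fib: "4 \<le> card {x \<in> N. comp_of N x = Q}" if "Q \<in> comp_of N ` N" for Q
  proof -
    obtain a where a: "a \<in> N" "Q = comp_of N a" using \<open>Q \<in> _\<close> by auto
    obtain b where b: "b \<in> N" "E a b" using succ a by blast
    obtain c where c: "c \<in> N" "E b c" using succ b by blast
    obtain d where d: "d \<in> N" "E c d" using succ c by blast
    have eqs: "comp_of N b = comp_of N a" "comp_of N c = comp_of N b" "comp_of N d = comp_of N c"
      using comp_of_eq a b c d unfolding adj_def by metis+
    have ne: "a \<noteq> b" "a \<noteq> c" "a \<noteq> d" "b \<noteq> c" "b \<noteq> d" "c \<noteq> d"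
      using b c d asym no_cycle3 irrefl by metis+
    have "{a, b, c, d} \<subseteq> {x \<in> N. comp_of N x = Q}" using a b c d eqs by auto
    then have "card {a, b, c, d} \<le> card {x \<in> N. comp_of N x = Q}"
      using fin by (intro card_mono) auto
    then show ?thesis using ne by simp
  qed
  have "4 * ncomp N = (\<Sum>Q \<in> comp_of N ` N. 4)" by (simp add: ncomp_def)
  also have "\<dots> \<le> (\<Sum>Q \<in> comp_of N ` N. card {x \<in> N. comp_of N x = Q})"
    by (intro sum_mono fib)
  also have "\<dots> = card N"
    using sum.image_gen[OF fin, of "\<lambda>_. 1::nat" "comp_of N"] by simp
  finally show ?thesis .
qed

section \<open>Triangle-free sets with large degrees\<close>

text \<open>Only transitive triangles are mentioned, as \<open>no_cycle3\<close> rules out the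
  cyclic ones.\<close>

definition triangle_free :: "'a set \<Rightarrow> bool" where
  "triangle_free V \<longleftrightarrow> (\<forall>x \<in> V. \<forall>y \<in> V. \<forall>z \<in> V. E x y \<longrightarrow> E y z \<longrightarrow> \<not> E x z)"

lemma triangle_freeD:
  assumes "triangle_free V" "x \<in> V" "y \<in> V" "z \<in> V" "adj x y" "adj y z"
  shows "\<not> adj x z"
  using assms no_cycle3 unfolding triangle_free_def adj_def by blast

lemma triangle_free_nbs_disjoint:
  assumes "triangle_free V" "x \<in> V" "y \<in> V" "adj x y"
  shows "nbs V x \<inter> nbs V y = {}"
  using triangle_freeD[OF assms(1)] assms(2-4) adj_sym unfolding nbs_def by blast

lemma card_nbs_add_le:
  assumes "finite V" "nbs V x \<inter> nbs V y = {}"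
  shows "card (nbs V x) + card (nbs V y) \<le> card V"
proof -
  have "card (nbs V x \<union> nbs V y) \<le> card V"
    using assms(1) by (intro card_mono) (auto simp: nbs_def)
  then show ?thesis using assms by (simp add: card_Un_disjoint)
qed

text \<open>Adjacent vertices have disjoint neighbourhoods, and two disjoint sets that each cover at
  least half of \<open>V\<close> cover exactly half.\<close>

lemma triangle_free_card_nbs:
  assumes fin: "finite V" and tf: "triangle_free V"
    and deg: "\<And>x. x \<in> V \<Longrightarrow> card V \<le> 2 * card (nbs V x)" and x: "x \<in> V"
  shows "2 * card (nbs V x) = card V" "nbs V x \<noteq> {}"
proof -
  have "card V > 0" using fin x card_gt_0_iff by blast
  then have "card (nbs V x) > 0" using deg[OF x] by simp
  then show "nbs V x \<noteq> {}" by auto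
  then obtain y where y: "y \<in> V" "adj x y" by (auto simp: nbs_def)
  have "card (nbs V x) + card (nbs V y) \<le> card V"
    by (intro card_nbs_add_le triangle_free_nbs_disjoint fin tf x y)
  then show "2 * card (nbs V x) = card V" using deg[OF x] deg[OF y(1)] by simp
qed

text \<open>If every \<open>cdeg\<close> exceeded half of \<open>card V\<close>, then
  \<open>tf\<close> would force all degrees to be exactly half, although \<open>cdeg\<close> is at
  most the degree. The form of \<open>tf\<close> is that of the induction hypothesis for
  \<open>V\<close>.\<close>

lemma ex_small_cdeg:
  assumes fin: "finite V" and ne: "V \<noteq> {}"
    and tf: "(\<And>x. x \<in> V \<Longrightarrow> card V \<le> 2 * cdeg V x) \<Longrightarrow> triangle_free V"
  shows "\<exists>x \<in> V. 2 * cdeg V x \<le> card V"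
proof (rule ccontr)
  assume neg: "\<not> ?thesis"
  have big: "card V < 2 * cdeg V x" if "x \<in> V" for x using neg that by auto
  have "triangle_free V" by (rule tf) (use big in force)
  moreover obtain x where x: "x \<in> V" using ne by blast
  ultimately have "2 * card (nbs V x) = card V"
    using triangle_free_card_nbs(1)[OF fin] big cdeg_le[OF fin]
    by (meson le_trans less_or_eq_imp_le mult_le_mono2)
  then show False using big[OF x] cdeg_le[OF fin, of x] by simp
qed

subsection \<open>Every arc has a common out-neighbour of its ends\<close>

lemma dense_case_False:
  assumes fin: "finite V" and ne: "V \<noteq> {}"
    and deg: "\<And>x. x \<in> V \<Longrightarrow> card V \<le> 2 * cdeg V x"
    and common: "\<And>u v. u \<in> V \<Longrightarrow> v \<in> V \<Longrightarrow> E u v \<Longrightarrow> \<exists>z \<in> V. E u z \<and> E v z"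
    and IH: "\<And>P. P \<subset> V \<Longrightarrow> P \<noteq> {} \<Longrightarrow> \<exists>x \<in> P. 2 * cdeg P x \<le> card P"
  shows False
proof -
  let ?o = "\<lambda>x. card (out V x)"
  have four: "4 * ncomp (out V x) \<le> ?o x" if "x \<in> V" for x
    using common that fin by (intro four_ncomp_le) (auto simp: out_def)
  have in_deg: "2 * card V \<le> 4 * card (inn V x) + ?o x" if "x \<in> V" for x
    using deg[OF that] four[OF that] by (simp add: cdeg_def)
  have degree_sum: "(\<Sum>x \<in> V. card (inn V x)) = (\<Sum>x \<in> V. ?o x)"
  proof -
    have "(\<Sum>x \<in> V. card (inn V x)) = (\<Sum>x \<in> V. \<Sum>y \<in> V. if E y x then 1 else 0)"
      using fin by (simp add: inn_def card_eq_sum sum.inter_filter del: sum_constant One_nat_def)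
    also have "\<dots> = (\<Sum>y \<in> V. \<Sum>x \<in> V. if E y x then 1 else 0)" by (rule sum.swap)
    also have "\<dots> = (\<Sum>y \<in> V. ?o y)"
      using fin by (simp add: out_def card_eq_sum sum.inter_filter del: sum_constant One_nat_def)
    finally show ?thesis .
  qed
  define \<Delta> where "\<Delta> = Max (?o ` V)"
  have le_\<Delta>: "?o x \<le> \<Delta>" if "x \<in> V" for x using fin that by (simp add: \<Delta>_def)
  \<comment> \<open>Summing \<open>in_deg\<close> and equating the in-degree and out-degree sums
    shows that the average out-degree is at least two fifths of \<open>card V\<close>.\<close>
  have "card V * (2 * card V) \<le> (\<Sum>x \<in> V. 4 * card (inn V x) + ?o x)"
    using sum_bounded_below[of V "2 * card V"] in_deg by auto
  also have "\<dots> = 4 * (\<Sum>x \<in> V. card (inn V x)) + (\<Sum>x \<in> V. ?o x)"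
    by (simp add: sum.distrib sum_distrib_left)
  finally have "card V * (2 * card V) \<le> 5 * (\<Sum>x \<in> V. ?o x)" using degree_sum by simp
  also have "\<dots> \<le> 5 * (card V * \<Delta>)" using sum_bounded_above[of V ?o \<Delta>] le_\<Delta> by auto
  finally have "card V * (2 * card V) \<le> card V * (5 * \<Delta>)" by simp
  then have large: "2 * card V \<le> 5 * \<Delta>" using fin ne by (simp add: card_gt_0_iff)
  have "\<Delta> \<in> ?o ` V" unfolding \<Delta>_def using fin ne by (intro Max_in) auto
  then obtain v where v: "v \<in> V" "?o v = \<Delta>" by auto
  define P where "P = inn V v"
  have "P \<subset> V" using v irrefl by (auto simp: P_def inn_def)
  have "out V v \<subset> V" using v irrefl by (auto simp: out_def)
  then have "\<Delta> < card V" using fin v psubset_card_mono by metis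
  then have "card P > 0" using in_deg[OF v(1)] v(2) by (simp add: P_def)
  then have "P \<noteq> {}" by auto
  then obtain w where w: "w \<in> P" "2 * cdeg P w \<le> card P" using IH[OF \<open>P \<subset> V\<close>] by blast
  have wV: "w \<in> V" "E w v" using w by (auto simp: P_def inn_def)
  have finP: "finite P" using fin by (simp add: P_def)
  \<comment> \<open>The in-neighbours of \<open>w\<close> inside \<open>P\<close> are already
    counted by \<open>cdeg P w\<close>.\<close>
  have t: "2 * card (inn V w \<inter> P) \<le> card P"
  proof -
    have "inn V w \<inter> P = inn P w" using \<open>P \<subset> V\<close> by (auto simp: inn_def)
    then show ?thesis using w by (simp add: cdeg_def)
  qed
  \<comment> \<open>A vertex of \<open>out V v\<close> with an arc to \<open>w\<close> would close a
    directed triangle with \<open>w\<close> and \<open>v\<close>.\<close>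
  have d1: "(inn V w \<union> P) \<inter> out V v = {}"
    using wV no_cycle3 asym unfolding P_def inn_def out_def by blast
  have d2: "v \<notin> inn V w \<union> P \<union> out V v"
    using wV asym irrefl by (auto simp: P_def inn_def out_def)
  have "insert v (inn V w \<union> P \<union> out V v) \<subseteq> V" using v by (auto simp: P_def inn_def out_def)
  then have "card (insert v (inn V w \<union> P \<union> out V v)) \<le> card V" using fin by (rule card_mono[rotated])
  then have "Suc (card (inn V w \<union> P) + \<Delta>) \<le> card V"
    using d1 d2 fin finP v by (simp add: card_Un_disjoint)
  moreover have "card (inn V w) + card P = card (inn V w \<union> P) + card (inn V w \<inter> P)"
    using fin finP by (intro card_Un_Int) auto
  moreover have "2 * card V \<le> 4 * card P + \<Delta>" using in_deg[OF v(1)] v(2) by (simp add: P_def)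
  moreover have "2 * card V \<le> 4 * card (inn V w) + \<Delta>" using in_deg[OF wV(1)] le_\<Delta>[OF wV(1)] by simp
  \<comment> \<open>With n = \<open>card V\<close>, both in-degrees are at least (2n - \<Delta>)/4,
    and by \<open>t\<close> the union has at least 3(2n - \<Delta>)/8 elements. Together with
    \<open>out V v\<close> this gives 5\<Delta> < 2n.\<close>
  ultimately show False using t large by linarith
qed

subsection \<open>Deleting the ends of an arc\<close>

text \<open>Adding both ends of an arc yields either one new in-neighbour and no new component, or
  at most one new component and no new in-neighbour.\<close>

lemma cdeg_insert2_le:
  assumes fin: "finite V" and uv: "E u v" and x: "x \<in> V"
    and not_both: "E u x \<Longrightarrow> \<not> E v x"
    and joined: "E u x \<Longrightarrow> E x v \<Longrightarrow> \<exists>z \<in> V. E x z \<and> adj z v"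
  shows "cdeg (insert u (insert v V)) x \<le> cdeg V x + 1"
proof -
  let ?W = "insert u (insert v V)"
  let ?f = "comp_of (out ?W x)"
  \<comment> \<open>Adding vertices can only merge components of \<open>out V x\<close>, so those of
    the larger set that meet \<open>out V x\<close> are no more numerous.\<close>
  have ge: "card (?f ` out V x) \<le> ncomp (out V x)"
    using fin by (intro ncomp_ge comp_of_eq) (auto simp: out_def adj_def)
  have nc: "ncomp (out ?W x) = card (?f ` out ?W x)" by (simp add: ncomp_def)
  consider "E u x" | "\<not> E u x" "E v x" | "\<not> E u x" "\<not> E v x" by blast
  then show ?thesis
  proof cases
    case 1
    then have "\<not> E x u" "\<not> E v x" using asym not_both by auto
    have "inn ?W x \<subseteq> insert u (inn V x)" using \<open>\<not> E v x\<close> by (auto simp: inn_def)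
    then have "card (inn ?W x) \<le> card (insert u (inn V x))" using fin by (intro card_mono) auto
    then have i: "card (inn ?W x) \<le> card (inn V x) + 1"
      using fin by (metis Suc_eq_plus1 card_insert_if finite_inn le_SucI)
    \<comment> \<open>The only possible new out-neighbour is \<open>v\<close>, which
      \<open>joined\<close> attaches to an old component.\<close>
    have "?f ` out ?W x \<subseteq> ?f ` out V x"
    proof
      fix Q assume "Q \<in> ?f ` out ?W x"
      then obtain w where w: "w \<in> out ?W x" "Q = ?f w" by auto
      show "Q \<in> ?f ` out V x"
      proof (cases "w \<in> V")
        case True
        then show ?thesis using w by (auto simp: out_def)
      next
        case False
        then have "w = v" "E x v" using w \<open>\<not> E x u\<close> by (auto simp: out_def)
        then obtain z where z: "z \<in> V" "E x z" "adj z v" using joined 1 by blast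
        then have "?f z = ?f v" using \<open>E x v\<close> by (intro comp_of_eq) (auto simp: out_def)
        then show ?thesis using z w \<open>w = v\<close> by (auto simp: out_def)
      qed
    qed
    then have "card (?f ` out ?W x) \<le> card (?f ` out V x)" using fin by (intro card_mono) auto
    then show ?thesis using i ge nc by (simp add: cdeg_def)
  next
    case 2
    \<comment> \<open>An arc from \<open>x\<close> to \<open>u\<close> would close the directed
      triangle through \<open>u\<close>, \<open>v\<close>, \<open>x\<close>.\<close>
    then have "\<not> E x u" "\<not> E x v" using uv no_cycle3 asym by blast+
    then have "out ?W x = out V x" by (auto simp: out_def)
    moreover have "inn ?W x \<subseteq> insert v (inn V x)" using 2 by (auto simp: inn_def)
    then have "card (inn ?W x) \<le> card (insert v (inn V x))" using fin by (intro card_mono) auto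
    then have "card (inn ?W x) \<le> card (inn V x) + 1"
      using fin by (metis Suc_eq_plus1 card_insert_if finite_inn le_SucI)
    ultimately show ?thesis by (simp add: cdeg_def)
  next
    case 3
    then have i: "inn ?W x = inn V x" by (auto simp: inn_def)
    \<comment> \<open>If both ends are out-neighbours of \<open>x\<close>, they are adjacent and
      share a component, so one representative \<open>c\<close> suffices; if neither is, its value
      is immaterial.\<close>
    define c where "c = (if E x v then v else u)"
    have "?f u = ?f v" if "E x u" "E x v"
      using that uv by (intro comp_of_eq) (auto simp: out_def adj_def)
    then have "?f ` out ?W x \<subseteq> insert (?f c) (?f ` out V x)"
      by (auto simp: out_def c_def)
    then have "card (?f ` out ?W x) \<le> card (insert (?f c) (?f ` out V x))"
      using fin by (intro card_mono) auto
    also have "\<dots> \<le> card (?f ` out V x) + 1"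
      using fin by (simp add: card_insert_if)
    finally show ?thesis using i ge nc by (simp add: cdeg_def)
  qed
qed

text \<open>Here \<open>a\<close>, and \<open>b\<close> if it is an out-neighbour of
  \<open>x\<close>, fall into the component of \<open>y\<close>, and no in-neighbour is gained.
  Using \<open>adj a b\<close> instead of an arc lets either end of the deleted arc play the role of
  \<open>a\<close>.\<close>

lemma cdeg_insert2_le_card_nbs:
  assumes fin: "finite V" and ab: "adj a b" and x: "x \<in> V"
    and y: "y \<in> V" "E x y" "E x a" "adj a y" and nb: "\<not> E b x"
  shows "cdeg (insert a (insert b V)) x \<le> card (nbs V x)"
proof -
  let ?W = "insert a (insert b V)"
  let ?f = "comp_of (out ?W x)"
  have i: "inn ?W x = inn V x" using nb y asym by (auto simp: inn_def)
  have "?f a = ?f y" using y by (intro comp_of_eq) (auto simp: out_def)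
  moreover have "?f b = ?f a" if "E x b"
    using that ab y adj_sym by (intro comp_of_eq) (auto simp: out_def)
  ultimately have "?f ` out ?W x \<subseteq> ?f ` out V x"
    using y by (auto simp: out_def)
  then have "card (?f ` out ?W x) \<le> card (?f ` out V x)" using fin by (intro card_mono) auto
  also have "\<dots> \<le> card (out V x)" using fin by (intro card_image_le) auto
  finally show ?thesis using i fin by (simp add: cdeg_def ncomp_def card_nbs)
qed

text \<open>Data of the induction step: after deletion of the arc \<open>uv\<close> the rest \<open>V\<close> is already known
  to be triangle-free.\<close>

context
  fixes V W :: "'a set" and u v :: 'a
  assumes fin: "finite V" and uv: "E u v" "u \<notin> V" "v \<notin> V" and W: "W = insert u (insert v V)"
    and deg: "\<And>x. x \<in> W \<Longrightarrow> card W \<le> 2 * cdeg W x"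
    and tf: "triangle_free V" and degV: "\<And>x. x \<in> V \<Longrightarrow> card V \<le> 2 * card (nbs V x)"
begin

lemma card_W: "card W = card V + 2"
  using fin uv irrefl by (auto simp: W card_insert_if)

text \<open>Degrees in \<open>V\<close> are exactly half of \<open>card V\<close>, and
  \<open>W\<close> has two more vertices; so every vertex of \<open>V\<close> must profit from
  \<open>u\<close> or \<open>v\<close>.\<close>

lemma cdeg_gt: "x \<in> V \<Longrightarrow> card (nbs V x) < cdeg W x"
  using deg[of x] triangle_free_card_nbs(1)[OF fin tf degV, of x] card_W by (simp add: W)

lemma ex_nbr: "x \<in> V \<Longrightarrow> \<exists>y \<in> V. adj x y"
  using triangle_free_card_nbs(2)[OF fin tf degV] by (fastforce simp: nbs_def)

text \<open>By \<open>cdeg_gt\<close> the bound \<open>cdeg_insert2_le_card_nbs\<close> must fail,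
  so its remaining hypothesis does: \<open>E v x\<close>. This closes a directed triangle.\<close>

lemma gain_u:
  assumes "x \<in> V" "y \<in> V" "E x y" "E x u" "adj u y"
  shows False
proof -
  have "E v x"
    using cdeg_insert2_le_card_nbs[OF fin _ assms, of v] cdeg_gt[of x] uv assms
    by (fastforce simp: W adj_def)
  then show False using uv assms no_cycle3 by blast
qed

text \<open>The same argument with \<open>u\<close> and \<open>v\<close> exchanged only gives
  \<open>E u x\<close>, since the resulting triangle is transitive.\<close>

lemma gain_v:
  assumes "x \<in> V" "y \<in> V" "E x y" "E x v" "adj v y"
  shows "E u x"
  using cdeg_insert2_le_card_nbs[OF fin _ assms, of u] cdeg_gt[of x] uv assms
  by (fastforce simp: W adj_def insert_commute)

lemma adj_u_or_v: "x \<in> V \<Longrightarrow> adj u x \<or> adj v x"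
proof (rule ccontr)
  assume x: "x \<in> V" and "\<not> (adj u x \<or> adj v x)"
  then have "nbs W x = nbs V x" by (auto simp: nbs_def W adj_def)
  moreover have "cdeg W x \<le> card (nbs W x)" using fin by (intro cdeg_le) (simp add: W)
  ultimately show False using cdeg_gt[OF x] by simp
qed

text \<open>A neighbour \<open>y\<close> of \<open>x\<close> in \<open>V\<close> is adjacent to
  \<open>u\<close> or \<open>v\<close>. Either adjacency creates a triangle to which
  \<open>gain_u\<close> or \<open>gain_v\<close> applies, with source \<open>x\<close> or
  \<open>y\<close>.\<close>

lemma no_common_in_nbr:
  assumes x: "x \<in> V" "E x u" "E x v"
  shows False
proof -
  obtain y where y: "y \<in> V" "adj x y" using ex_nbr x by blast
  have "E x y \<or> E y x" using y by (simp add: adj_def)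
  then show False
  proof
    assume "E x y"
    then show False using adj_u_or_v[OF y(1)] gain_u[of x y] gain_v[of x y] x y asym by blast
  next
    assume yx: "E y x"
    have "\<not> adj u y"
    proof
      assume "adj u y"
      then have "E y u" using x yx no_cycle3[of u y x] by (auto simp: adj_def)
      then show False using gain_u[of y x] x y yx by (auto simp: adj_def)
    qed
    then have "adj v y" using adj_u_or_v y by blast
    then have "E y v" using x yx no_cycle3[of v y x] by (auto simp: adj_def)
    then have "E u y" using gain_v[of y x] x y yx by (auto simp: adj_def)
    then show False using \<open>\<not> adj u y\<close> by (simp add: adj_def)
  qed
qed

lemma triangle_free_if_isolated:
  assumes iso: "\<And>z. z \<in> V \<Longrightarrow> E u z \<Longrightarrow> \<not> adj z v"
  shows "triangle_free W"
proof -
  have finW: "finite W" using fin by (simp add: W)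
  have disj: "\<not> (adj u z \<and> adj v z)" if "z \<in> V" for z
    using iso[OF that] no_common_in_nbr[OF that] no_cycle3 uv unfolding adj_def by blast
  then have "nbs W u \<inter> nbs W v = {}"
    using irrefl adj_irrefl by (auto simp: nbs_def W)
  \<comment> \<open>The two degrees add up to at most \<open>card W\<close>, while each
    \<open>cdeg\<close> is at least half of it. So both ends attain equality and neither is the
    source of a triangle.\<close>
  then have sum: "card (nbs W u) + card (nbs W v) \<le> card W" by (rule card_nbs_add_le[OF finW])
  have "\<not> adj y z" if c: "c = u \<or> c = v" and yz: "y \<in> out W c" "z \<in> out W c" for c y z
  proof
    assume "adj y z"
    then have "cdeg W c < card (nbs W c)" using cdeg_less[OF finW] yz by blast
    moreover have "cdeg W u \<le> card (nbs W u)" "cdeg W v \<le> card (nbs W v)" using cdeg_le finW by auto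
    moreover have "card W \<le> 2 * cdeg W u" "card W \<le> 2 * cdeg W v" using deg by (auto simp: W)
    ultimately show False using sum c by auto
  qed
  then have src: "\<not> adj y z" if "c = u \<or> c = v" "y \<in> W" "z \<in> W" "E c y" "E c z" for c y z
    using that by (auto simp: out_def)
  \<comment> \<open>Triangles with source in \<open>V\<close> and exactly one vertex in
    {\<open>u\<close>, \<open>v\<close>}: \<open>gain_u\<close> excludes \<open>u\<close>, and
    \<open>gain_v\<close> would make \<open>x\<close> adjacent to both ends.\<close>
  have side: "False" if "x \<in> V" "y \<in> V" "E x y" "c = u \<or> c = v" "E x c" "adj c y" for x y c
    using that gain_u gain_v[of x y] disj[of x] unfolding adj_def by metis
  show ?thesis unfolding triangle_free_def
  proof (intro ballI impI notI)
    fix x y z assume xyz: "x \<in> W" "y \<in> W" "z \<in> W" "E x y" "E y z" "E x z"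
    then have xV: "x \<in> V" using src[of x y z] by (auto simp: W adj_def)
    show False
    proof (cases "y \<in> V")
      case True
      then have "z = u \<or> z = v" using xyz xV tf unfolding W triangle_free_def by blast
      then show ?thesis using side[of x y z] xyz xV True by (simp add: adj_def)
    next
      case yn: False
      show ?thesis
      proof (cases "z \<in> V")
        case True
        moreover have "y = u \<or> y = v" using xyz yn by (auto simp: W)
        ultimately show ?thesis using side[of x z y] xyz xV by (simp add: adj_def)
      next
        case False
        then show ?thesis using yn xyz disj[OF xV] irrefl unfolding W adj_def by blast
      qed
    qed
  qed
qed

text \<open>Every neighbour of \<open>u\<close> in \<open>V\<close> turns out to be an out-neighbour
  with an arc to \<open>v\<close>. Thus \<open>u\<close> has no in-neighbour and a connected
  out-neighbourhood, so \<open>cdeg W u\<close> is too small.\<close>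

lemma False_if_no_isolated:
  assumes ne: "V \<noteq> {}"
    and no_common: "\<And>z. z \<in> V \<Longrightarrow> E u z \<Longrightarrow> \<not> E v z"
    and no_isolated: "\<And>x y. x \<in> W \<Longrightarrow> y \<in> W \<Longrightarrow> E x y \<Longrightarrow> \<exists>z \<in> W. E x z \<and> adj z y"
  shows False
proof -
  \<comment> \<open>The vertex joining \<open>y\<close> to another out-neighbour of \<open>x\<close>
    is outside \<open>V\<close> by triangle-freeness and is not \<open>u\<close> by
    \<open>gain_u\<close>; so it is \<open>v\<close>.\<close>
  have arc: "E u x" "E x v" "adj v y" if xy: "x \<in> V" "y \<in> V" "E x y" for x y
  proof -
    obtain z where z: "z \<in> W" "E x z" "adj z y" using no_isolated xy unfolding W by blast
    have "z \<notin> V" using tf z xy no_cycle3 unfolding triangle_free_def adj_def by blast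
    moreover have "z \<noteq> u" using gain_u[of x y] z xy by blast
    ultimately have "z = v" using z by (auto simp: W)
    then show "E x v" "adj v y" "E u x" using z xy gain_v by auto
  qed
  have sink: "E v x \<and> \<not> adj u x" if x: "x \<in> V" and no_out: "\<And>y. y \<in> V \<Longrightarrow> \<not> E x y" for x
  proof -
    obtain y where y: "y \<in> V" "E y x" using ex_nbr x no_out by (auto simp: adj_def)
    note yx = arc[OF y(1) x y(2)]
    have nxu: "\<not> E x u" using yx y no_cycle3 by blast
    have "\<not> E x v"
    proof
      assume "E x v"
      then obtain z where z: "z \<in> W" "E x z" "adj z v"
        using no_isolated[of x v] x by (auto simp: W)
      then show False using no_out nxu adj_irrefl by (auto simp: W)
    qed
    then have "E v x" using yx by (simp add: adj_def)
    then show ?thesis using nxu no_common[OF x] by (auto simp: adj_def)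
  qed
  have src: "E u x \<and> E x v" if "x \<in> V" "adj u x" for x
    using that sink arc by blast
  have "inn W u = {}"
    using src uv irrefl asym unfolding inn_def W adj_def by blast
  moreover have "comp_of (out W u) ` out W u \<subseteq> {comp_of (out W u) v}"
  proof (rule image_subsetI)
    fix x assume x: "x \<in> out W u"
    then have "x = v \<or> adj x v" using src irrefl by (auto simp: out_def W adj_def)
    then show "comp_of (out W u) x \<in> {comp_of (out W u) v}"
      using comp_of_eq[of x "out W u" v] x uv by (auto simp: out_def W)
  qed
  then have "ncomp (out W u) \<le> 1"
    unfolding ncomp_def using card_mono[of "{comp_of (out W u) v}"] by fastforce
  ultimately have "cdeg W u \<le> 1" by (simp add: cdeg_def)
  then have "card W \<le> 2" using deg[of u] by (simp add: W)
  then show False using card_W ne fin by simp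
qed

end

section \<open>The induction on the number of vertices\<close>

lemma triangle_free_if_cdeg_ge:
  assumes "finite W" "\<And>x. x \<in> W \<Longrightarrow> card W \<le> 2 * cdeg W x"
  shows "triangle_free W"
  using assms
proof (induction "card W" arbitrary: W rule: less_induct)
  case less
  note fin = less.prems(1) and deg = less.prems(2)
  \<comment> \<open>The order drops by two and each \<open>cdeg\<close> by at most one, so the
    degree condition is inherited by \<open>V\<close>.\<close>
  have delete: "triangle_free V \<and> (\<forall>x \<in> V. card V \<le> 2 * card (nbs V x))"
    if uv: "u \<in> W" "v \<in> W" "E u v" and V: "V = W - {u, v}"
      and "\<And>x. x \<in> V \<Longrightarrow> E u x \<Longrightarrow> \<not> E v x"
      and "\<And>x. x \<in> V \<Longrightarrow> E u x \<Longrightarrow> E x v \<Longrightarrow> \<exists>z \<in> V. E x z \<and> adj z v" for u v V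
  proof -
    have WV: "W = insert u (insert v V)" using uv V by auto
    have finV: "finite V" using fin V by simp
    have card: "card W = card V + 2"
      using finV irrefl uv unfolding WV by (auto simp: V card_insert_if)
    have deg': "card V \<le> 2 * cdeg V x" if "x \<in> V" for x
    proof -
      have "cdeg W x \<le> cdeg V x + 1"
        unfolding WV using finV uv that \<open>\<And>x. x \<in> V \<Longrightarrow> E u x \<Longrightarrow> \<not> E v x\<close>
          \<open>\<And>x. x \<in> V \<Longrightarrow> E u x \<Longrightarrow> E x v \<Longrightarrow> \<exists>z \<in> V. E x z \<and> adj z v\<close>
        by (intro cdeg_insert2_le) auto
      then show ?thesis using deg[of x] that card V by auto
    qed
    have "triangle_free V" using less.hyps[of V] card finV deg' by simp
    moreover have "card V \<le> 2 * card (nbs V x)" if "x \<in> V" for x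
      using deg'[OF that] cdeg_le[OF finV, of x] by linarith
    ultimately show ?thesis by blast
  qed
  show ?case
  proof (cases "\<exists>u \<in> W. \<exists>v \<in> W. E u v \<and> (\<forall>z \<in> W. E u z \<longrightarrow> \<not> adj z v)")
    case True
    then obtain u v where uv: "u \<in> W" "v \<in> W" "E u v"
      and iso: "\<And>z. z \<in> W \<Longrightarrow> E u z \<Longrightarrow> \<not> adj z v" by blast
    define V where "V = W - {u, v}"
    have "triangle_free V \<and> (\<forall>x \<in> V. card V \<le> 2 * card (nbs V x))"
      using iso by (intro delete[OF uv V_def]) (auto simp: V_def adj_def)
    then have "triangle_free V" "\<And>x. x \<in> V \<Longrightarrow> card V \<le> 2 * card (nbs V x)" by auto
    moreover have "finite V" "u \<notin> V" "v \<notin> V" "W = insert u (insert v V)"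
      using fin uv by (auto simp: V_def)
    moreover have "\<not> adj z v" if "z \<in> V" "E u z" for z using iso that by (simp add: V_def)
    ultimately show ?thesis using triangle_free_if_isolated[of V u v W] uv deg by presburger
  next
    case no_iso: False
    show ?thesis
    proof (cases "\<exists>u \<in> W. \<exists>v \<in> W. E u v \<and> (\<forall>z \<in> W. E u z \<longrightarrow> \<not> E v z)")
      case True
      then obtain u v where uv: "u \<in> W" "v \<in> W" "E u v"
        and nc: "\<And>z. z \<in> W \<Longrightarrow> E u z \<Longrightarrow> \<not> E v z" by blast
      define V where "V = W - {u, v}"
      \<comment> \<open>The vertex supplied for the arc from \<open>x\<close> to \<open>v\<close> is
        not \<open>u\<close>, because \<open>E u x\<close> forbids the reverse arc; hence it
        survives the deletion.\<close>
      have joined: "\<exists>z \<in> V. E x z \<and> adj z v" if x: "x \<in> V" "E u x" "E x v" for x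
      proof -
        obtain z where "z \<in> W" "E x z" "adj z v" using no_iso x uv by (auto simp: V_def)
        moreover have "z \<noteq> u" "z \<noteq> v" using calculation x asym adj_irrefl by auto
        ultimately show ?thesis by (auto simp: V_def)
      qed
      have "triangle_free V \<and> (\<forall>x \<in> V. card V \<le> 2 * card (nbs V x))"
        using nc joined by (intro delete[OF uv V_def]) (auto simp: V_def)
      then have "triangle_free V" "\<And>x. x \<in> V \<Longrightarrow> card V \<le> 2 * card (nbs V x)" by auto
      moreover have "finite V" "u \<notin> V" "v \<notin> V" "W = insert u (insert v V)"
        using fin uv by (auto simp: V_def)
      moreover obtain z where "z \<in> W" "E u z" "adj z v" using no_iso uv by blast
      then have "V \<noteq> {}" using irrefl adj_irrefl by (auto simp: V_def)
      moreover have "\<not> E v z" if "z \<in> V" "E u z" for z using nc that by (simp add: V_def)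
      moreover have "\<exists>z \<in> W. E x z \<and> adj z y" if "x \<in> W" "y \<in> W" "E x y" for x y
        using no_iso that by blast
      ultimately have False using False_if_no_isolated[of V u v W] uv deg by presburger
      then show ?thesis ..
    next
      case False
      have "W = {}"
      proof (rule ccontr)
        assume "W \<noteq> {}"
        then show False
        proof (rule dense_case_False[OF fin _ deg])
          fix P assume P: "P \<subset> W" "P \<noteq> {}"
          then have "finite P" "card P < card W" using fin finite_subset psubset_card_mono by blast+
          then show "\<exists>x \<in> P. 2 * cdeg P x \<le> card P"
            using less.hyps[of P] P by (intro ex_small_cdeg) auto
        qed (use False in blast)+
      qed
      then show ?thesis by (simp add: triangle_free_def)
    qed
  qed
qed

section \<open>The balanced complete bipartite structure\<close>

lemma bipartition_if_cdeg_ge: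
  assumes fin: "finite V" and deg: "\<And>x. x \<in> V \<Longrightarrow> card V \<le> 2 * cdeg V x"
  shows "\<exists>A B. V = A \<union> B \<and> A \<inter> B = {} \<and> 2 * card A = card V \<and> 2 * card B = card V
    \<and> (\<forall>x \<in> V. \<forall>y \<in> V. adj x y \<longleftrightarrow> x \<in> A \<and> y \<in> B \<or> x \<in> B \<and> y \<in> A)"
proof (cases "V = {}")
  case False
  have tf: "triangle_free V" using triangle_free_if_cdeg_ge[OF fin deg] .
  have deg': "card V \<le> 2 * card (nbs V x)" if "x \<in> V" for x
    using deg[OF that] cdeg_le[OF fin, of x] by linarith
  have card_nbs': "2 * card (nbs V x) = card V" "nbs V x \<noteq> {}" if "x \<in> V" for x
    using triangle_free_card_nbs[OF fin tf deg' that] by auto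
  obtain x where x: "x \<in> V" using False by blast
  then obtain y where y: "y \<in> V" "adj x y" using card_nbs'(2) by (auto simp: nbs_def)
  let ?A = "nbs V x" and ?B = "nbs V y"
  have disj: "?A \<inter> ?B = {}" by (rule triangle_free_nbs_disjoint[OF tf x y])
  have cards: "2 * card ?A = card V" "2 * card ?B = card V" using card_nbs'(1) x y by auto
  have "?A \<union> ?B = V"
  proof (rule card_subset_eq[OF fin])
    show "?A \<union> ?B \<subseteq> V" by (auto simp: nbs_def)
    show "card (?A \<union> ?B) = card V" using cards disj fin by (simp add: card_Un_disjoint)
  qed
  \<comment> \<open>Neighbourhoods of adjacent vertices are disjoint halves of \<open>V\<close>,
    hence complements of each other.\<close>
  have full: "nbs V a = V - nbs V c" if "a \<in> nbs V c" "c \<in> V" for a c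
  proof (rule card_subset_eq)
    have a: "a \<in> V" "adj c a" using that by (auto simp: nbs_def)
    show "nbs V a \<subseteq> V - nbs V c"
      using triangle_free_nbs_disjoint[OF tf \<open>c \<in> V\<close> a] by (auto simp: nbs_def)
    have "card (V - nbs V c) = card V - card (nbs V c)"
      using fin by (intro card_Diff_subset) (auto simp: nbs_def)
    then show "card (nbs V a) = card (V - nbs V c)"
      using card_nbs'(1)[OF a(1)] card_nbs'(1)[OF \<open>c \<in> V\<close>] by linarith
  qed (use fin in simp)
  have "adj a b \<longleftrightarrow> a \<in> ?A \<and> b \<in> ?B \<or> a \<in> ?B \<and> b \<in> ?A" if "a \<in> V" "b \<in> V" for a b
  proof -
    have "adj a b \<longleftrightarrow> b \<in> nbs V a" using that by (simp add: nbs_def)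
    moreover have "V - ?A = ?B" "V - ?B = ?A" using disj \<open>?A \<union> ?B = V\<close> by auto
    ultimately show ?thesis
      using full[of a x] full[of a y] x y disj \<open>?A \<union> ?B = V\<close> that by auto
  qed
  then show ?thesis
    using \<open>?A \<union> ?B = V\<close> disj cards by (intro exI[of _ ?A] exI[of _ ?B]) simp
qed auto

end

subsection \<open>Components and reachability\<close>

text \<open>The subgraph induced by the reachability class of a vertex of \<open>C\<close> is
  connected and contains \<open>C\<close>, so maximality identifies the two.\<close>

lemma components_subset:
  assumes "wf_digraph H"
  shows "components H \<subseteq> (\<lambda>x. H \<restriction> {y. x \<rightarrow>\<^sup>*\<^bsub>mk_symmetric H\<^esub> y}) ` verts H"
proof
  interpret H: wf_digraph H by fact
  interpret S: pair_wf_digraph "mk_symmetric H" by (rule H.wellformed_mk_symmetric)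
  fix C assume "C \<in> components H"
  then have sub: "subgraph C H" and con: "connected C"
    and max: "\<And>H'. subgraph C H' \<Longrightarrow> subgraph H' H \<Longrightarrow> connected H' \<Longrightarrow> H' = C"
    by (auto simp: components_def pre_digraph.max_subgraph_def)
  obtain x where x: "x \<in> verts C"
    using con by (auto simp: connected_def strongly_connected_def)
  then have xH: "x \<in> verts H" using sub by (auto simp: subgraph_def)
  define X where "X = {y. x \<rightarrow>\<^sup>*\<^bsub>mk_symmetric H\<^esub> y}"
  have XH: "X \<subseteq> verts H" unfolding X_def using S.reachable_in_verts(2) by auto
  have CX: "verts C \<subseteq> X"
  proof
    fix y assume "y \<in> verts C"
    then have "x \<rightarrow>\<^sup>*\<^bsub>mk_symmetric C\<^esub> y"
      using con x by (auto simp: connected_def strongly_connected_def)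
    then show "y \<in> X"
      by (simp add: X_def pre_digraph.reachable_mono[OF _ subgraph_mk_symmetric[OF sub]])
  qed
  interpret C: wf_digraph C using sub by (simp add: subgraph_def)
  interpret HX: wf_digraph "H \<restriction> X" by (rule H.wellformed_induce_subgraph)
  interpret SX: pair_wf_digraph "mk_symmetric (H \<restriction> X)" by (rule HX.wellformed_mk_symmetric)
  \<comment> \<open>A walk from \<open>x\<close> never leaves the class \<open>X\<close>, so it
    survives in the induced subgraph.\<close>
  have "x \<rightarrow>\<^sup>*\<^bsub>mk_symmetric (H \<restriction> X)\<^esub> y" if "x \<rightarrow>\<^sup>*\<^bsub>mk_symmetric H\<^esub> y" for y
    using that
  proof (induction rule: S.reachable_induct)
    case base
    then show ?case by (intro SX.reachable_refl) (simp add: X_def xH)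
  next
    case (step y z)
    then have "x \<rightarrow>\<^sup>*\<^bsub>mk_symmetric H\<^esub> z" by (auto intro: S.reachable_adj_trans)
    then have "y \<in> X" "z \<in> X" using step by (auto simp: X_def)
    then have "y \<rightarrow>\<^bsub>mk_symmetric (H \<restriction> X)\<^esub> z" using step by (auto simp: parcs_mk_symmetric)
    then show ?case using step SX.reachable_adj_trans[of x y z] by simp
  qed
  then have reach: "x \<rightarrow>\<^sup>*\<^bsub>mk_symmetric (H \<restriction> X)\<^esub> y" if "y \<in> X" for y using that by (simp add: X_def)
  have "connected (H \<restriction> X)"
    unfolding connected_def
  proof (rule strongly_connectedI)
    show "verts (with_proj (mk_symmetric (H \<restriction> X))) \<noteq> {}" using CX x by auto
    fix y z assume "y \<in> verts (with_proj (mk_symmetric (H \<restriction> X)))"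
      "z \<in> verts (with_proj (mk_symmetric (H \<restriction> X)))"
    then show "y \<rightarrow>\<^sup>*\<^bsub>mk_symmetric (H \<restriction> X)\<^esub> z"
      using reach symmetric_reachable[OF symmetric_mk_symmetric] SX.reachable_trans
      by (metis induce_subgraph_verts pverts_mk_symmetric with_proj_simps(1))
  qed
  moreover have "subgraph (H \<restriction> X) H" using H.induced_induce[OF XH] by (rule induced_imp_subgraph)
  moreover have "subgraph C (H \<restriction> X)"
    using sub CX C.tail_in_verts C.head_in_verts HX.wf_digraph_axioms C.wf_digraph_axioms
    by (fastforce simp: subgraph_def compatible_def)
  ultimately have "H \<restriction> X = C" by (intro max)
  then show "C \<in> (\<lambda>x. H \<restriction> {y. x \<rightarrow>\<^sup>*\<^bsub>mk_symmetric H\<^esub> y}) ` verts H"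
    using xH unfolding X_def by blast
qed

lemma (in triangle_avoiding) card_components_le_ncomp:
  assumes D: "wf_digraph D" and fin: "finite N" and E: "E = dominates D"
  shows "card (components (D \<restriction> N)) \<le> ncomp N"
proof -
  interpret D: wf_digraph D by fact
  let ?S = "mk_symmetric (D \<restriction> N)"
  interpret H: wf_digraph "D \<restriction> N" by (rule D.wellformed_induce_subgraph)
  interpret S: pair_wf_digraph ?S by (rule H.wellformed_mk_symmetric)
  let ?f = "\<lambda>x. {y. x \<rightarrow>\<^sup>*\<^bsub>?S\<^esub> y}"
  have "components (D \<restriction> N) \<subseteq> (\<lambda>C. (D \<restriction> N) \<restriction> C) ` ?f ` N"
    using components_subset[OF H.wf_digraph_axioms] by (simp add: image_image)
  then have "card (components (D \<restriction> N)) \<le> card ((\<lambda>C. (D \<restriction> N) \<restriction> C) ` ?f ` N)"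
    using fin by (intro card_mono) auto
  also have "\<dots> \<le> card (?f ` N)" using fin by (intro card_image_le) auto
  also have "\<dots> \<le> ncomp N"
  proof (rule ncomp_ge[OF fin])
    fix x y assume "x \<in> N" "y \<in> N" "E x y"
    then have "x \<rightarrow>\<^bsub>?S\<^esub> y" "y \<rightarrow>\<^bsub>?S\<^esub> x"
      by (auto simp: E parcs_mk_symmetric arcs_ends_conv)
    then show "?f x = ?f y"
      using S.adj_reachable_trans[of x y] S.adj_reachable_trans[of y x] by auto
  qed
  finally show ?thesis .
qed

section \<open>Transfer to digraphs with arcs\<close>

lemma has_directed_triangleI:
  assumes "wf_digraph D" "x \<rightarrow>\<^bsub>D\<^esub> y" "y \<rightarrow>\<^bsub>D\<^esub> z" "z \<rightarrow>\<^bsub>D\<^esub> x" "x \<noteq> y" "y \<noteq> z" "z \<noteq> x"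
  shows "has_directed_triangle D"
proof -
  interpret D: wf_digraph D by fact
  obtain a b c where "a \<in> arcs D" "tail D a = x" "head D a = y"
    "b \<in> arcs D" "tail D b = y" "head D b = z" "c \<in> arcs D" "tail D c = z" "head D c = x"
    using assms by (metis reachableE)
  then have "D.cycle [a, b, c]"
    using assms unfolding D.cycle_def
    by (intro exI[of _ x]) (auto simp: D.awalk_Cons_iff D.awalk_Nil_iff)
  then show ?thesis unfolding has_directed_triangle_def by (metis length_Cons list.size(3) numeral_3_eq_3)
qed

theorem theorem5:
  fixes D :: "('a, 'b) pre_digraph" and n :: nat
  assumes "oriented_graph D"
    and "card (verts D) = n"
    and "\<forall>v \<in> verts D. real (in_degree D v) + real (out_component_number D v) \<ge> real n / 2"
  shows "has_directed_triangle D \<or>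
    (even n \<and> (\<exists>K :: 'a pair_pre_digraph.
      complete_bipartite_digraph (n div 2) (n div 2) (with_proj K) \<and>
      orientation_of D (with_proj K)))"
proof (cases "has_directed_triangle D")
  case no_triangle: False
  obtain G :: "'a pair_pre_digraph" where "orientation_of D (with_proj G)"
    using assms(1) by (auto simp: oriented_graph_def)
  then have D: "digraph D" and asymD: "\<And>x y. x \<rightarrow>\<^bsub>D\<^esub> y \<Longrightarrow> \<not> y \<rightarrow>\<^bsub>D\<^esub> x"
    by (auto simp: orientation_of_def)
  interpret D: digraph D by (rule D)
  interpret triangle_avoiding "dominates D"
  proof
    fix x y z assume "x \<rightarrow>\<^bsub>D\<^esub> y" "y \<rightarrow>\<^bsub>D\<^esub> z"
    then show "\<not> z \<rightarrow>\<^bsub>D\<^esub> x"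
      using no_triangle has_directed_triangleI[OF D.wf_digraph_axioms] D.adj_not_same by metis
  qed (rule asymD)
  let ?V = "verts D"
  have "card ?V \<le> 2 * cdeg ?V v" if v: "v \<in> ?V" for v
  proof -
    have in_le: "in_degree D v \<le> card (inn ?V v)"
    proof -
      \<comment> \<open>In-degrees count arcs; without parallel arcs they are determined by their
        tails.\<close>
      have "inj_on (tail D) (in_arcs D v)"
        using D.no_multi_arcs by (auto simp: inj_on_def in_arcs_def arc_to_ends_def)
      moreover have "tail D ` in_arcs D v \<subseteq> inn ?V v"
        unfolding inn_def by (auto simp: in_arcs_def arcs_ends_conv)
      ultimately show ?thesis
        unfolding in_degree_def by (intro card_inj_on_le) auto
    qed
    have out_le: "out_component_number D v \<le> ncomp (out ?V v)"
    proof -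
      have "out_neighbors D v = out ?V v"
        using D.adj_in_verts by (auto simp: out_neighbors_def out_def)
      then show ?thesis unfolding out_component_number_def
        by (simp add: card_components_le_ncomp[OF D.wf_digraph_axioms])
    qed
    have "real n \<le> real (2 * (in_degree D v + out_component_number D v))"
      using assms(3) v by force
    then have "n \<le> 2 * (in_degree D v + out_component_number D v)"
      by (simp only: of_nat_le_iff)
    also have "\<dots> \<le> 2 * cdeg ?V v"
      unfolding cdeg_def by (intro mult_le_mono2 add_mono in_le out_le)
    finally show ?thesis using assms(2) by simp
  qed
  then obtain A B where AB: "?V = A \<union> B" "A \<inter> B = {}" "2 * card A = n" "2 * card B = n"
    and adj: "\<And>x y. x \<in> ?V \<Longrightarrow> y \<in> ?V \<Longrightarrow> adj x y \<longleftrightarrow> x \<in> A \<and> y \<in> B \<or> x \<in> B \<and> y \<in> A"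
    using bipartition_if_cdeg_ge[of ?V] assms(2) by auto
  \<comment> \<open>The graph sought is the underlying undirected graph of \<open>D\<close>.\<close>
  define K where "K = \<lparr> pverts = ?V, parcs = {(x, y). adj x y} \<rparr>"
  have inV: "x \<in> ?V \<and> y \<in> ?V" if "adj x y" for x y
    using that D.adj_in_verts by (auto simp: adj_def)
  have "adj x y \<longleftrightarrow> x \<in> A \<and> y \<in> B \<or> x \<in> B \<and> y \<in> A" for x y
    using adj[of x y] inV[of x y] AB(1) by blast
  then have "parcs K = A \<times> B \<union> B \<times> A" by (auto simp: K_def)
  moreover have "card A = n div 2" "card B = n div 2" using AB by auto
  ultimately have K: "complete_bipartite_digraph (n div 2) (n div 2) (with_proj K)"
    unfolding complete_bipartite_digraph_pair_def using AB(1,2) D.finite_verts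
    by (intro conjI exI[of _ A] exI[of _ B]) (simp_all add: K_def)
  moreover have "orientation_of D (with_proj K)"
    using K D asymD unfolding orientation_of_def complete_bipartite_digraph_def
    by (auto simp: K_def adj_def)
  moreover have "even n" using AB(3) by presburger
  ultimately show ?thesis by blast
qed simp

end
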